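(* The real Hessian matrix $H^R$ of $f_R$ at a point $(W,\Re(V),\Im(V))\in\mathcal R_r$, with $W=(w_i)_{1\le i\le r}\in\mathbb R^r$ and $V=[v_i]_{1\le i\le r}\in\mathbb C^{n\times r}$, is the block matrix $$H^R=\begin{bmatrix}A&\Re(B)^t&-\Im(B)^t\\ \Re(B)&\Re(C+D)&-\Im(C+D)\\ -\Im(B)&\Im(D-C)&\Re(D-C)\end{bmatrix}\in\mathbb R^{(r+2nr)\times(r+2nr)},$$ with - $A=\Re\big([(v_i^*v_j)^d]_{1\le i,j\le r}\big)\in\mathbb R^{r\times r}$, - $B=\Big[d\,w_i(v_j^*v_i)^{d-1}\bar v_j+\delta_{i,j}\Big(d\sum_{l=1}^rw_l(v_l^*v_i)^{d-1}\bar v_l-\nabla_{\mathbf x}\bar{\mathbf p}(v_j)\Big)\Big]_{1\le i,j\le r}\in\mathbb C^{nr\times r}$, where $\delta_{i,j}$ is the Kronecker delta, - $C=\mathrm{diag}\Big[d(d-1)\Big[\sum_{i=1}^rw_iw_j\overline{v_{i,k}}\,\overline{v_{i,l}}\,(v_i^*v_j)^{d-2}\Big]_{1\le k,l\le n}-w_j\Delta_{\mathbf x}\bar{\mathbf p}(v_j)\Big]_{1\le j\le r}\in\mathbb C^{nr\times nr}$, where $\Delta_{\mathbf x}\bar{\mathbf p}(v_j):=[\partial_{x_k}\partial_{x_l}\bar{\mathbf p}(v_j)]_{1\le k,l\le n}$, - $D=\Big[d\,w_iw_j(v_i^*v_j)^{d-2}\big((v_i^*v_j)I_n+(d-1)v_jv_i^*\big)\Big]_{1\le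 i,j\le r}\in\mathbb C^{nr\times nr}$.
   Context: $\mathbb C[\mathbf x]_d$ is the space of homogeneous polynomials of degree $d$ in $\mathbf x=(x_1,\dots,x_n)$. Writing $\mathbf p=\sum_{|\alpha|=d}\binom d\alpha p_\alpha\mathbf x^\alpha$, $\mathbf q=\sum_{|\alpha|=d}\binom d\alpha q_\alpha\mathbf x^\alpha$, the apolar product is $\langle\mathbf p,\mathbf q\rangle_d=\sum_{|\alpha|=d}\binom d\alpha\bar p_\alpha q_\alpha$ and $\|\mathbf p\|_d=\sqrt{\langle\mathbf p,\mathbf p\rangle_d}$; $\bar{\mathbf p}=\sum_{|\alpha|=d}\binom d\alpha\bar p_\alpha\mathbf x^\alpha$ is the polynomial with conjugated coefficients. ${}^t$ is transpose, ${}^*$ conjugate transpose, $\nabla_{\mathbf x}$ the vector of partial derivatives $\partial_{x_1},\dots,\partial_{x_n}$, and $v_{i,k}$ is the $k$-th coordinate of $v_i$. In block matrices $[\,\cdot\,]_{1\le i,j\le r}$, $i$ indexes block rows and $j$ block columns. Standing assumptions: $d>2$ and $r<r_g$, where $r_g=\lceil\frac1n\binom{n+d-1}{d}\rceil$ is the generic symmetric rank, increased by $1$ for $(d,n)\in\{(3,5),(4,3),(4,4),(4,5)\}$. A polynomial $\mathbf p\in\mathbb C[\mathbf x]_d$ is fixed. $\mathcal R_r=\{(W,\Re(V),\Im(V)): W\in\mathbb R^r,\ V\in\mathbb C^{n\times r}\}\simeq\mathbb R^{r+2nr}$, with coordinates ordered as $(W,\Re v_1,\dots,\Re v_r,\Im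 v_1,\dots,\Im v_r)$, and $f_R:\mathcal R_r\to\mathbb R$, $f_R(W,\Re V,\Im V)=\frac12\|\sum_{i=1}^rw_i(v_i^t\mathbf x)^d-\mathbf p\|_d^2$. The Hessian is the ordinary matrix of real second-order partial derivatives. *)

theory Defs
  imports "HOL-Analysis.Analysis" "HOL-Library.Poly_Mapping"
begin

text \<open>
  A polynomial maps exponent vectors to coefficients with finite support; the ring operations are
  those that \<^theory>\<open>HOL-Library.Poly_Mapping\<close> provides on this type.
\<close>

type_synonym 'n cpoly = "('n \<Rightarrow>\<^sub>0 nat) \<Rightarrow>\<^sub>0 complex"

definition exp_degree :: "('n::finite \<Rightarrow>\<^sub>0 nat) \<Rightarrow> nat" where
  "exp_degree \<alpha> = (\<Sum>k\<in>UNIV. Poly_Mapping.lookup \<alpha> k)"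

definition homogeneous :: "nat \<Rightarrow> 'n::finite cpoly \<Rightarrow> bool" where
  "homogeneous d p \<longleftrightarrow> (\<forall>\<alpha>\<in>Poly_Mapping.keys p. exp_degree \<alpha> = d)"

definition const_poly :: "complex \<Rightarrow> 'n cpoly" where
  "const_poly c = Poly_Mapping.single 0 c"

definition linear_form :: "complex ^ 'n \<Rightarrow> 'n::finite cpoly" where
  "linear_form v = (\<Sum>k\<in>UNIV. Poly_Mapping.single (Poly_Mapping.single k 1) (v $ k))"

definition poly_eval :: "'n::finite cpoly \<Rightarrow> complex ^ 'n \<Rightarrow> complex" where
  "poly_eval p x =
    (\<Sum>\<alpha>\<in>Poly_Mapping.keys p.
      Poly_Mapping.lookup p \<alpha> * (\<Prod>k\<in>UNIV. (x $ k) ^ Poly_Mapping.lookup \<alpha> k))"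

text \<open>
  Formal partial derivative. A monomial not involving the variable \<open>k\<close> contributes 0, so the
  truncated subtraction of exponents is harmless.
\<close>

definition poly_pd :: "'n \<Rightarrow> 'n cpoly \<Rightarrow> 'n cpoly" where
  "poly_pd k p =
    (\<Sum>\<alpha>\<in>Poly_Mapping.keys p.
      Poly_Mapping.single (\<alpha> - Poly_Mapping.single k 1)
        (of_nat (Poly_Mapping.lookup \<alpha> k) * Poly_Mapping.lookup p \<alpha>))"

definition poly_grad :: "'n::finite cpoly \<Rightarrow> complex ^ 'n \<Rightarrow> complex ^ 'n" where
  "poly_grad p x = (\<chi> k. poly_eval (poly_pd k p) x)"

definition poly_hess :: "'n::finite cpoly \<Rightarrow> complex ^ 'n \<Rightarrow> complex ^ 'n ^ 'n" where
  "poly_hess p x = (\<chi> k l. poly_eval (poly_pd k (poly_pd l p)) x)"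

text \<open>
  Conjugating the coefficients is the same as conjugating the \<open>p\<^sub>\<alpha>\<close> below, since the multinomial
  coefficients are real.
\<close>

definition conj_poly :: "'n cpoly \<Rightarrow> 'n cpoly" where
  "conj_poly p = Poly_Mapping.map cnj p"

definition multinom :: "nat \<Rightarrow> ('n::finite \<Rightarrow>\<^sub>0 nat) \<Rightarrow> complex" where
  "multinom d \<alpha> = fact d / (\<Prod>k\<in>UNIV. fact (Poly_Mapping.lookup \<alpha> k))"

text \<open>
  The coordinates \<open>p\<^sub>\<alpha>\<close> with respect to the scaled monomials:
  $p = \sum_{|\alpha| = d} \binom{d}{\alpha} p_\alpha \mathbf x^\alpha$.
\<close>

definition apolar_coeff :: "nat \<Rightarrow> 'n::finite cpoly \<Rightarrow> ('n \<Rightarrow>\<^sub>0 nat) \<Rightarrow> complex" where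
  "apolar_coeff d p \<alpha> = Poly_Mapping.lookup p \<alpha> / multinom d \<alpha>"

definition apolar :: "nat \<Rightarrow> 'n::finite cpoly \<Rightarrow> 'n cpoly \<Rightarrow> complex" where
  "apolar d p q =
    (\<Sum>\<alpha> | exp_degree \<alpha> = d. multinom d \<alpha> * cnj (apolar_coeff d p \<alpha>) * apolar_coeff d q \<alpha>)"

text \<open>The product of a polynomial with itself is real and nonnegative.\<close>

definition apolar_norm :: "nat \<Rightarrow> 'n::finite cpoly \<Rightarrow> real" where
  "apolar_norm d p = sqrt (Re (apolar d p p))"

text \<open>The index set of \<^const>\<open>apolar\<close> is finite, so that sum is never the junk value 0.\<close>

lemma finite_exp_degree: "finite {\<alpha> :: 'n::finite \<Rightarrow>\<^sub>0 nat. exp_degree \<alpha> = d}"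
proof (rule finite_imageD)
  show "inj_on Poly_Mapping.lookup {\<alpha> :: 'n \<Rightarrow>\<^sub>0 nat. exp_degree \<alpha> = d}"
    by (simp add: inj_on_def)
  have "Poly_Mapping.lookup \<alpha> k \<le> exp_degree \<alpha>" for \<alpha> :: "'n \<Rightarrow>\<^sub>0 nat" and k
    unfolding exp_degree_def by (rule member_le_sum) auto
  then have "Poly_Mapping.lookup ` {\<alpha> :: 'n \<Rightarrow>\<^sub>0 nat. exp_degree \<alpha> = d} \<subseteq> PiE UNIV (\<lambda>_. {..d})"
    by auto
  then show "finite (Poly_Mapping.lookup ` {\<alpha> :: 'n \<Rightarrow>\<^sub>0 nat. exp_degree \<alpha> = d})"
    by (rule finite_subset) (auto intro: finite_PiE)
qed

definition generic_rank :: "nat \<Rightarrow> nat \<Rightarrow> nat" where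
  "generic_rank d n =
    nat \<lceil>real ((n + d - 1) choose d) / real n\<rceil>
      + (if (d, n) \<in> {(3, 5), (4, 3), (4, 4), (4, 5)} then 1 else 0)"

text \<open>
  The coordinates of $\mathbb R^{r + 2nr}$ are labelled by a sum type: \<open>Inl i\<close> is \<open>w\<^sub>i\<close>,
  \<open>Inr (Inl (i, k))\<close> is the real part and \<open>Inr (Inr (i, k))\<close> the imaginary part of the \<open>k\<close>-th
  coordinate of \<open>v\<^sub>i\<close>. The vectors \<open>v\<^sub>i\<close> are the columns of \<open>V\<close>.
\<close>

type_synonym ('r, 'n) coords = "'r + ('r \<times> 'n + 'r \<times> 'n)"

definition weights :: "real ^ ('r::finite, 'n::finite) coords \<Rightarrow> real ^ 'r" where
  "weights x = (\<chi> i. x $ Inl i)"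

definition vectors :: "real ^ ('r::finite, 'n::finite) coords \<Rightarrow> complex ^ 'r ^ 'n" where
  "vectors x = (\<chi> k i. Complex (x $ Inr (Inl (i, k))) (x $ Inr (Inr (i, k))))"

definition real_point ::
  "real ^ 'r \<Rightarrow> complex ^ 'r ^ 'n \<Rightarrow> real ^ ('r::finite, 'n::finite) coords" where
  "real_point W V =
    (\<chi> s. case s of
        Inl i \<Rightarrow> W $ i
      | Inr (Inl (i, k)) \<Rightarrow> Re (V $ k $ i)
      | Inr (Inr (i, k)) \<Rightarrow> Im (V $ k $ i))"

lemma weights_real_point [simp]: "weights (real_point W V) = W"
  by (simp add: weights_def real_point_def vec_eq_iff)

lemma vectors_real_point [simp]: "vectors (real_point W V) = V"
  by (simp add: vectors_def real_point_def vec_eq_iff complex_eq_iff)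

definition f_R :: "nat \<Rightarrow> 'n cpoly \<Rightarrow> real ^ ('r::finite, 'n::finite) coords \<Rightarrow> real" where
  "f_R d p x =
    1 / 2 * (apolar_norm d
      ((\<Sum>i\<in>UNIV. const_poly (of_real (weights x $ i)) * linear_form (column i (vectors x)) ^ d)
        - p))\<^sup>2"

definition has_partial_deriv :: "(real ^ 'a::finite \<Rightarrow> real) \<Rightarrow> 'a \<Rightarrow> real \<Rightarrow> real ^ 'a \<Rightarrow> bool" where
  "has_partial_deriv f i D x \<longleftrightarrow>
    ((\<lambda>t. f (x + t *\<^sub>R axis i 1)) has_real_derivative D) (at 0)"

text \<open>
  The first-order partial derivatives \<open>g\<close> exist near \<open>x\<close>, and the second-order ones exist at \<open>x\<close>
  and are the entries of \<open>H\<close>: \<open>H $ i $ j\<close> is $\partial_i \partial_j f(x)$. Such an \<open>H\<close> is unique.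
\<close>

definition has_hessian :: "(real ^ 'a::finite \<Rightarrow> real) \<Rightarrow> real ^ 'a ^ 'a \<Rightarrow> real ^ 'a \<Rightarrow> bool" where
  "has_hessian f H x \<longleftrightarrow>
    (\<exists>g. (\<forall>j. \<forall>\<^sub>F y in nhds x. has_partial_deriv f j (g j y) y) \<and>
         (\<forall>i j. has_partial_deriv (g j) i (H $ i $ j) x))"

definition hcat :: "'a ^ 'c1 ^ 'm \<Rightarrow> 'a ^ 'c2 ^ 'm \<Rightarrow> 'a ^ ('c1::finite + 'c2::finite) ^ 'm" where
  "hcat M N = (\<chi> i s. case s of Inl a \<Rightarrow> M $ i $ a | Inr b \<Rightarrow> N $ i $ b)"

definition vcat :: "'a ^ 'm ^ 'r1 \<Rightarrow> 'a ^ 'm ^ 'r2 \<Rightarrow> 'a ^ 'm ^ ('r1::finite + 'r2::finite)" where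
  "vcat M N = (\<chi> s. case s of Inl a \<Rightarrow> M $ a | Inr b \<Rightarrow> N $ b)"

text \<open>
  The matrix with blocks \<open>M i j\<close>, where \<open>i\<close> indexes block rows and \<open>j\<close> block columns. In
  \<open>block_vectors\<close> each block is a single column.
\<close>

definition block_matrix ::
  "('r \<Rightarrow> 's \<Rightarrow> 'a ^ 'm ^ 'n) \<Rightarrow> 'a ^ ('s::finite \<times> 'm::finite) ^ ('r::finite \<times> 'n::finite)" where
  "block_matrix M = (\<chi> s t. case (s, t) of ((i, k), (j, l)) \<Rightarrow> M i j $ k $ l)"

definition block_vectors :: "('r \<Rightarrow> 's \<Rightarrow> 'a ^ 'n) \<Rightarrow> 'a ^ 's ^ ('r::finite \<times> 'n::finite)" where
  "block_vectors u = (\<chi> s j. case s of (i, k) \<Rightarrow> u i j $ k)"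

definition block_diag ::
  "('r \<Rightarrow> ('a::zero) ^ 'n ^ 'n) \<Rightarrow> 'a ^ ('r::finite \<times> 'n::finite) ^ ('r \<times> 'n)" where
  "block_diag M = block_matrix (\<lambda>i j. if i = j then M j else 0)"

definition star_prod :: "complex ^ 'n \<Rightarrow> complex ^ 'n::finite \<Rightarrow> complex" where
  "star_prod u v = (\<Sum>k\<in>UNIV. cnj (u $ k) * v $ k)"

definition conj_vec :: "complex ^ 'n \<Rightarrow> complex ^ 'n::finite" where
  "conj_vec v = (\<chi> k. cnj (v $ k))"

definition hess_A :: "nat \<Rightarrow> complex ^ 'r ^ 'n \<Rightarrow> real ^ 'r::finite ^ 'r" where
  "hess_A d V =
    (let v = (\<lambda>i. column i V)
     in map_matrix Re (\<chi> i j. star_prod (v i) (v j) ^ d))"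

definition hess_B ::
  "nat \<Rightarrow> 'n cpoly \<Rightarrow> real ^ 'r \<Rightarrow> complex ^ 'r ^ 'n
    \<Rightarrow> complex ^ 'r ^ ('r::finite \<times> 'n::finite)" where
  "hess_B d p W V =
    (let v = (\<lambda>i. column i V); w = (\<lambda>i. complex_of_real (W $ i))
     in block_vectors (\<lambda>i j.
          (of_nat d * w i * star_prod (v j) (v i) ^ (d - 1)) *s conj_vec (v j)
          + (if i = j
             then of_nat d *s (\<Sum>l\<in>UNIV. (w l * star_prod (v l) (v i) ^ (d - 1)) *s conj_vec (v l))
                  - poly_grad (conj_poly p) (v j)
             else 0)))"

definition hess_C ::
  "nat \<Rightarrow> 'n cpoly \<Rightarrow> real ^ 'r \<Rightarrow> complex ^ 'r ^ 'n
    \<Rightarrow> complex ^ ('r::finite \<times> 'n::finite) ^ ('r \<times> 'n)" where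
  "hess_C d p W V =
    (let v = (\<lambda>i. column i V); w = (\<lambda>i. complex_of_real (W $ i))
     in block_diag (\<lambda>j. \<chi> k l.
          of_nat (d * (d - 1))
            * (\<Sum>i\<in>UNIV. w i * w j * cnj (v i $ k) * cnj (v i $ l) * star_prod (v i) (v j) ^ (d - 2))
          - w j * poly_hess (conj_poly p) (v j) $ k $ l))"

definition hess_D ::
  "nat \<Rightarrow> real ^ 'r \<Rightarrow> complex ^ 'r ^ 'n
    \<Rightarrow> complex ^ ('r::finite \<times> 'n::finite) ^ ('r \<times> 'n)" where
  "hess_D d W V =
    (let v = (\<lambda>i. column i V); w = (\<lambda>i. complex_of_real (W $ i))
     in block_matrix (\<lambda>i j. \<chi> k l.
          of_nat d * w i * w j * star_prod (v i) (v j) ^ (d - 2)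
            * (star_prod (v i) (v j) * mat 1 $ k $ l
               + of_nat (d - 1) * (v j $ k * cnj (v i $ l)))))"

end

theory Submission
  imports Defs
begin

text \<open>
  The apolar product is made for powers of linear forms: by the multinomial theorem,
  $\langle \mathbf p, (v^t \mathbf x)^d \rangle_d
      = \bar{\mathbf p}(v)$ (\<open>apolar_linear_form_power\<close>), and in
  particular $\langle (u^t \mathbf x)^d, (v^t \mathbf x)^d \rangle_d = (u^* v)^d$. Expanding the
  squared norm therefore turns the objective into an explicit function (\<open>f_R_expand\<close>)
  \[ f_R = \Re\Big(\tfrac12 \sum_{i,j} w_i w_j (v_i^* v_j)^d - \sum_i w_i \bar{\mathbf p}(v_i)
      + \tfrac12 \langle \mathbf p, \mathbf p \rangle_d\Big). \]

  Differentiating it along a line, the quadratic part yields a sum of two conjugate terms, and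
  the real part keeps either of them (\<open>f_R_line\<close>). So the derivative in \<open>w\<^sub>i\<close> is the real part of
  $\sum_j w_j (v_j^* v_i)^d - \bar{\mathbf p}(v_i)$, and the derivative in the direction of $v_j$ is
  $\Re(h_j^t \, \mathrm d v_j)$ with
  $h_j = w_j \big(d \sum_m w_m (v_m^* v_j)^{d-1} \bar v_m - \nabla \bar{\mathbf p}(v_j)\big)$.
  The derivatives in $\Re v_j$ and $\Im v_j$ are thus $\Re h_j$ and $-\Im h_j$.

  The vector $h_j$ is differentiated once more. Its derivative in the weights is the block \<open>B\<close>.
  When $v_{i,k}$ moves in the complex direction \<open>c\<close>, the component $h_{j,l}$ moves by
  $c\, C_{(i,k),(j,l)} + \bar c\, D_{(i,k),(j,l)}$ (\<open>vector_grad_line_vector\<close>): \<open>C\<close> is the holomorphic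
  part and is block diagonal because $v_i$ enters $h_j$ holomorphically only for \<open>i = j\<close>, and \<open>D\<close> is
  the antiholomorphic part. Taking \<open>c = 1\<close> and \<open>c = \<i>\<close>, and then real and negative imaginary parts,
  produces the four lower right blocks. The matrix entry in row \<open>s\<close> and column \<open>t\<close> appears
  as the derivative in direction \<open>s\<close> of the partial derivative in \<open>t\<close>.
\<close>

section \<open>Powers of linear forms\<close>

definition monom_eval :: "complex ^ 'n::finite \<Rightarrow> ('n \<Rightarrow>\<^sub>0 nat) \<Rightarrow> complex" where
  "monom_eval x \<alpha> = (\<Prod>k\<in>UNIV. (x $ k) ^ Poly_Mapping.lookup \<alpha> k)"

lemma monom_eval_add: "monom_eval x (\<alpha> + \<beta>) = monom_eval x \<alpha> * monom_eval x \<beta>"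
  by (simp add: monom_eval_def lookup_add power_add prod.distrib)

lemma monom_eval_single: "monom_eval x (Poly_Mapping.single k 1) = x $ k"
proof -
  have "monom_eval x (Poly_Mapping.single k 1) = (\<Prod>j\<in>UNIV. if j = k then x $ k else 1)"
    unfolding monom_eval_def by (rule prod.cong) (auto simp: lookup_single when_def)
  then show ?thesis by simp
qed

lemma cnj_monom_eval: "cnj (monom_eval x \<alpha>) = monom_eval (conj_vec x) \<alpha>"
  by (simp add: monom_eval_def conj_vec_def)

lemma exp_degree_single_add: "exp_degree (Poly_Mapping.single k 1 + \<beta>) = Suc (exp_degree \<beta>)"
  by (simp add: exp_degree_def lookup_add lookup_single sum.distrib when_def)

text \<open>
  Subtraction of exponents is truncated, so this is where positivity of the exponent matters.
\<close>

lemma exponent_split: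
  assumes "Poly_Mapping.lookup \<alpha> k > 0"
  shows "\<alpha> = Poly_Mapping.single k (1::nat) + (\<alpha> - Poly_Mapping.single k 1)"
  using assms by (intro poly_mapping_eqI) (auto simp: lookup_add lookup_minus lookup_single when_def)

lemma multinom_nonzero: "multinom d \<alpha> \<noteq> 0"
  by (simp add: multinom_def)

lemma cnj_multinom: "cnj (multinom d \<alpha>) = multinom d \<alpha>"
  by (simp add: multinom_def)

text \<open>
  Multinomial form of $(m + 1) \binom{n + 1}{m + 1} = (n + 1) \binom{n}{m}$. Summed over \<open>k\<close>,
  it gives the Pascal recurrence that drives the multinomial theorem below.
\<close>

lemma multinom_single_add:
  "of_nat (Suc d) * multinom d \<beta>
    = of_nat (Suc (Poly_Mapping.lookup \<beta> k)) * multinom (Suc d) (Poly_Mapping.single k 1 + \<beta>)"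
proof -
  let ?f = "\<lambda>\<beta>. (\<Prod>j\<in>UNIV. fact (Poly_Mapping.lookup \<beta> j)) :: complex"
  have "?f (Poly_Mapping.single k 1 + \<beta>) =
      (\<Prod>j\<in>UNIV. (if j = k then of_nat (Suc (Poly_Mapping.lookup \<beta> k)) else 1)
          * fact (Poly_Mapping.lookup \<beta> j))"
    by (rule prod.cong) (auto simp: lookup_add lookup_single when_def)
  also have "\<dots> = of_nat (Suc (Poly_Mapping.lookup \<beta> k)) * ?f \<beta>"
    by (simp add: prod.distrib)
  finally have *: "?f (Poly_Mapping.single k 1 + \<beta>) = of_nat (Suc (Poly_Mapping.lookup \<beta> k)) * ?f \<beta>" .
  have "(of_nat (Suc (Poly_Mapping.lookup \<beta> k)) :: complex) \<noteq> 0" by (rule of_nat_neq_0)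
  then show ?thesis
    unfolding multinom_def * by (simp add: field_simps del: of_nat_Suc)
qed

lemma lookup_single_mult_add:
  fixes P :: "'n cpoly"
  shows "Poly_Mapping.lookup (Poly_Mapping.single \<beta> c * P) (\<beta> + \<gamma>) = c * Poly_Mapping.lookup P \<gamma>"
  by (simp add: lookup_mult lookup_single when_mult)

lemma lookup_variable_mult_eq_0:
  fixes P :: "'n cpoly"
  assumes "Poly_Mapping.lookup \<alpha> k = 0"
  shows "Poly_Mapping.lookup (Poly_Mapping.single (Poly_Mapping.single k 1) c * P) \<alpha> = 0"
proof -
  have "\<alpha> \<noteq> Poly_Mapping.single k 1 + q" for q
    using assms by (auto simp: lookup_add)
  then show ?thesis by (simp add: lookup_mult lookup_single when_mult)
qed

lemma lookup_linear_form_mult: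
  "Poly_Mapping.lookup (linear_form v * P) \<alpha> =
    (\<Sum>k\<in>UNIV. if Poly_Mapping.lookup \<alpha> k > 0
      then v $ k * Poly_Mapping.lookup P (\<alpha> - Poly_Mapping.single k 1) else 0)"
proof -
  have "Poly_Mapping.lookup (linear_form v * P) \<alpha> =
    (\<Sum>k\<in>UNIV. Poly_Mapping.lookup (Poly_Mapping.single (Poly_Mapping.single k 1) (v $ k) * P) \<alpha>)"
    by (simp add: linear_form_def sum_distrib_right lookup_sum)
  also have "\<dots> = (\<Sum>k\<in>UNIV. if Poly_Mapping.lookup \<alpha> k > 0
      then v $ k * Poly_Mapping.lookup P (\<alpha> - Poly_Mapping.single k 1) else 0)"
  proof (rule sum.cong[OF refl])
    fix k
    show "Poly_Mapping.lookup (Poly_Mapping.single (Poly_Mapping.single k 1) (v $ k) * P) \<alpha> =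
      (if Poly_Mapping.lookup \<alpha> k > 0
      then v $ k * Poly_Mapping.lookup P (\<alpha> - Poly_Mapping.single k 1) else 0)"
    proof (cases "Poly_Mapping.lookup \<alpha> k > 0")
      case True
      show ?thesis
        using True lookup_single_mult_add[of "Poly_Mapping.single k 1" "v $ k" P
            "\<alpha> - Poly_Mapping.single k 1"]
          exponent_split[OF True] by simp
    next
      case False
      then show ?thesis using lookup_variable_mult_eq_0 by simp
    qed
  qed
  finally show ?thesis .
qed

text \<open>
  The multinomial theorem, read off coefficientwise: in degree \<open>d + 1\<close>, the recurrence
  \<open>lookup_linear_form_mult\<close> contributes, for each variable occurring in \<open>\<alpha>\<close>, a fraction
  $\alpha_k / (d + 1)$ of the expected coefficient, and these fractions add up to
  $|\alpha| / (d + 1)$.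
\<close>

lemma lookup_linear_form_power:
  "Poly_Mapping.lookup (linear_form v ^ d) \<alpha> =
    (if exp_degree \<alpha> = d then multinom d \<alpha> * monom_eval v \<alpha> else 0)"
proof (induction d arbitrary: \<alpha>)
  case 0
  have "exp_degree \<alpha> = 0 \<longleftrightarrow> \<alpha> = 0"
    by (auto simp: exp_degree_def intro: poly_mapping_eqI)
  then show ?case
    by (auto simp: lookup_one multinom_def monom_eval_def)
next
  case (Suc d)
  let ?L = "Poly_Mapping.lookup \<alpha>"
  let ?X = "(if exp_degree \<alpha> = Suc d then multinom (Suc d) \<alpha> * monom_eval v \<alpha> else 0)
      / of_nat (Suc d)"
  have term_eq: "(if ?L k > 0
      then v $ k * Poly_Mapping.lookup (linear_form v ^ d) (\<alpha> - Poly_Mapping.single k 1) else 0)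
      = of_nat (?L k) * ?X" for k
  proof (cases "?L k > 0")
    case True
    define \<beta> where "\<beta> = \<alpha> - Poly_Mapping.single k 1"
    have \<alpha>: "\<alpha> = Poly_Mapping.single k 1 + \<beta>"
      unfolding \<beta>_def by (rule exponent_split[OF True])
    have L: "?L k = Suc (Poly_Mapping.lookup \<beta> k)"
      unfolding \<alpha> by (simp add: lookup_add)
    have "exp_degree \<alpha> = Suc d \<longleftrightarrow> exp_degree \<beta> = d"
      unfolding \<alpha> exp_degree_single_add by simp
    moreover have "multinom d \<beta> = of_nat (?L k) * multinom (Suc d) \<alpha> / of_nat (Suc d)"
      using multinom_single_add[of d \<beta> k] unfolding L \<alpha>[symmetric]
      by (metis nonzero_mult_div_cancel_left of_nat_neq_0)
    then have "v $ k * (multinom d \<beta> * monom_eval v \<beta>)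
        = of_nat (?L k) * (multinom (Suc d) \<alpha> * monom_eval v \<alpha> / of_nat (Suc d))"
      unfolding \<alpha> monom_eval_add monom_eval_single by simp
    ultimately show ?thesis
      using True Suc.IH[of \<beta>] unfolding \<beta>_def[symmetric] by simp
  qed simp
  have "Poly_Mapping.lookup (linear_form v ^ Suc d) \<alpha> = (\<Sum>k\<in>UNIV. of_nat (?L k) * ?X)"
    unfolding power_Suc lookup_linear_form_mult term_eq ..
  also have "\<dots> = of_nat (exp_degree \<alpha>) * ?X"
    unfolding exp_degree_def of_nat_sum sum_distrib_right ..
  also have "\<dots> = (if exp_degree \<alpha> = Suc d then multinom (Suc d) \<alpha> * monom_eval v \<alpha> else 0)"
    by (auto simp del: of_nat_Suc)
  finally show ?case .
qed

lemma homogeneous_linear_form_power: "homogeneous d (linear_form v ^ d)"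
  unfolding homogeneous_def by (metis lookup_linear_form_power in_keys_iff)

section \<open>Conjugation and evaluation of polynomials\<close>

lemma lookup_conj_poly: "Poly_Mapping.lookup (conj_poly p) \<alpha> = cnj (Poly_Mapping.lookup p \<alpha>)"
  by (simp add: conj_poly_def map.rep_eq when_def)

lemma keys_conj_poly: "Poly_Mapping.keys (conj_poly p) = Poly_Mapping.keys p"
  by (auto simp: in_keys_iff lookup_conj_poly)

lemma conj_poly_linear_form_power: "conj_poly (linear_form v ^ d) = linear_form (conj_vec v) ^ d"
  by (intro poly_mapping_eqI)
    (simp add: lookup_conj_poly lookup_linear_form_power cnj_monom_eval cnj_multinom)

text \<open>
  Any finite set containing the support may be summed over; polynomials with different supports,
  and the index set of the apolar product, are handled through this.
\<close>

lemma poly_eval_superset: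
  assumes "finite S" "Poly_Mapping.keys p \<subseteq> S"
  shows "poly_eval p x = (\<Sum>\<alpha>\<in>S. Poly_Mapping.lookup p \<alpha> * monom_eval x \<alpha>)"
  unfolding poly_eval_def monom_eval_def
  by (rule sum.mono_neutral_left) (use assms in \<open>auto simp: in_keys_iff\<close>)

lemma poly_eval_add: "poly_eval (p + q) x = poly_eval p x + poly_eval q x"
proof -
  let ?S = "Poly_Mapping.keys p \<union> Poly_Mapping.keys q"
  have "Poly_Mapping.keys (p + q) \<subseteq> ?S" by (rule Poly_Mapping.keys_add)
  then show ?thesis
    by (simp add: poly_eval_superset[where S = ?S] lookup_add distrib_right sum.distrib)
qed

lemma poly_eval_0: "poly_eval 0 x = 0"
  by (simp add: poly_eval_def)

lemma poly_eval_sum: "poly_eval (\<Sum>i\<in>I. p i) x = (\<Sum>i\<in>I. poly_eval (p i) x)"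
  by (induction I rule: infinite_finite_induct) (simp_all add: poly_eval_0 poly_eval_add)

lemma poly_eval_single: "poly_eval (Poly_Mapping.single \<alpha> c) x = c * monom_eval x \<alpha>"
  by (simp add: poly_eval_def monom_eval_def)

lemma sum_single_lookup: "(\<Sum>\<alpha>\<in>Poly_Mapping.keys p. Poly_Mapping.single \<alpha> (Poly_Mapping.lookup p \<alpha>)) = p"
  by (rule poly_mapping_eqI) (auto simp: lookup_sum lookup_single when_def in_keys_iff)

lemma poly_eval_mult: "poly_eval (p * q) x = poly_eval p x * poly_eval q x"
proof -
  let ?s = "\<lambda>p \<alpha>. Poly_Mapping.single \<alpha> (Poly_Mapping.lookup p \<alpha>)"
  have "poly_eval (p * q) x =
      poly_eval ((\<Sum>\<alpha>\<in>Poly_Mapping.keys p. ?s p \<alpha>) * (\<Sum>\<beta>\<in>Poly_Mapping.keys q. ?s q \<beta>)) x"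
    by (simp only: sum_single_lookup)
  also have "\<dots> = poly_eval p x * poly_eval q x"
    by (simp add: sum_product poly_eval_sum mult_single poly_eval_single monom_eval_add
        poly_eval_def[of p] poly_eval_def[of q] monom_eval_def[symmetric] mult_ac)
  finally show ?thesis .
qed

lemma poly_eval_power: "poly_eval (p ^ m) x = poly_eval p x ^ m"
proof (induction m)
  case 0
  have "poly_eval 1 x = 1"
    using poly_eval_single[of 0 1 x] by (simp add: monom_eval_def)
  then show ?case by simp
qed (simp add: poly_eval_mult)

lemma poly_eval_linear_form: "poly_eval (linear_form v) x = (\<Sum>k\<in>UNIV. v $ k * x $ k)"
  by (simp only: linear_form_def poly_eval_sum poly_eval_single monom_eval_single)

section \<open>The apolar product\<close>

text \<open>
  In terms of ordinary coefficients, the weight of the apolar product is the inverse of the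
  multinomial coefficient. It cancels the one in the expansion of a power of a linear form.
\<close>

lemma apolar_lookup: "apolar d p q =
    (\<Sum>\<alpha> | exp_degree \<alpha> = d. cnj (Poly_Mapping.lookup p \<alpha>) * Poly_Mapping.lookup q \<alpha> / multinom d \<alpha>)"
  unfolding apolar_def apolar_coeff_def
  by (rule sum.cong) (auto simp: cnj_multinom multinom_nonzero field_simps)

lemma apolar_commute: "apolar d q p = cnj (apolar d p q)"
  by (simp add: apolar_lookup cnj_multinom mult.commute)

lemma apolar_diff_right: "apolar d p (q - q') = apolar d p q - apolar d p q'"
  by (simp add: apolar_lookup lookup_minus right_diff_distrib diff_divide_distrib sum_subtractf)

lemma apolar_diff_left: "apolar d (p - p') q = apolar d p q - apolar d p' q"
  by (simp add: apolar_lookup lookup_minus left_diff_distrib diff_divide_distrib sum_subtractf)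

lemma apolar_sum_right: "apolar d p (\<Sum>i\<in>I. q i) = (\<Sum>i\<in>I. apolar d p (q i))"
  unfolding apolar_lookup lookup_sum sum_distrib_left sum_divide_distrib by (rule sum.swap)

lemma apolar_sum_left: "apolar d (\<Sum>i\<in>I. p i) q = (\<Sum>i\<in>I. apolar d (p i) q)"
  by (subst (1 2) apolar_commute) (simp add: apolar_sum_right)

lemma lookup_const_poly_mult:
  "Poly_Mapping.lookup (const_poly c * q) \<alpha> = c * Poly_Mapping.lookup q \<alpha>"
  using lookup_single_mult_add[of 0 c q \<alpha>] by (simp add: const_poly_def)

lemma apolar_const_mult_right: "apolar d p (const_poly c * q) = c * apolar d p q"
  unfolding apolar_lookup lookup_const_poly_mult sum_distrib_left
  by (rule sum.cong) (simp_all add: mult_ac)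

lemma apolar_const_mult_left: "apolar d (const_poly c * p) q = cnj c * apolar d p q"
  by (subst (1 2) apolar_commute) (simp add: apolar_const_mult_right)

text \<open>
  The reproducing property: powers of linear forms represent evaluation, up to the conjugation
  caused by the first argument of the product.
\<close>

lemma apolar_linear_form_power:
  assumes "homogeneous d p"
  shows "apolar d p (linear_form v ^ d) = poly_eval (conj_poly p) v"
proof -
  have "apolar d p (linear_form v ^ d) =
      (\<Sum>\<alpha> | exp_degree \<alpha> = d. Poly_Mapping.lookup (conj_poly p) \<alpha> * monom_eval v \<alpha>)"
    unfolding apolar_lookup
    by (rule sum.cong) (auto simp: lookup_linear_form_power lookup_conj_poly multinom_nonzero)
  also have "\<dots> = poly_eval (conj_poly p) v"
    using assms by (intro poly_eval_superset[symmetric])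
      (auto simp: finite_exp_degree keys_conj_poly homogeneous_def)
  finally show ?thesis .
qed

text \<open>
  The case of the reproducing property where \<open>p\<close> is itself a power of a linear form; its conjugate
  is the power of the conjugate form.
\<close>

lemma apolar_linear_form_powers:
  "apolar d (linear_form u ^ d) (linear_form v ^ d) = star_prod u v ^ d"
  by (simp add: apolar_linear_form_power homogeneous_linear_form_power conj_poly_linear_form_power
      poly_eval_power poly_eval_linear_form star_prod_def conj_vec_def)

text \<open>
  The square root in the norm is harmless, since its argument is a sum of nonnegative terms.
\<close>

lemma apolar_norm_squared: "(apolar_norm d p)\<^sup>2 = Re (apolar d p p)"
proof -
  have "Re (multinom d \<alpha> * cnj z * z) \<ge> 0" for \<alpha> :: "'a \<Rightarrow>\<^sub>0 nat" and z
  proof -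
    have "multinom d \<alpha> = of_real (fact d / (\<Prod>k\<in>UNIV. fact (Poly_Mapping.lookup \<alpha> k)))"
      by (simp add: multinom_def)
    moreover have "cnj z * z = of_real ((norm z)\<^sup>2)"
      by (metis complex_norm_square mult.commute of_real_power)
    ultimately have "multinom d \<alpha> * cnj z * z =
        of_real (fact d / (\<Prod>k\<in>UNIV. fact (Poly_Mapping.lookup \<alpha> k)) * (norm z)\<^sup>2)"
      by (metis mult.assoc of_real_mult)
    then show ?thesis
      by (simp only: Re_complex_of_real) (simp add: prod_nonneg)
  qed
  then have "Re (apolar d p p) \<ge> 0"
    unfolding apolar_def by (simp add: sum_nonneg)
  then show ?thesis by (simp add: apolar_norm_def)
qed

section \<open>The objective and its gradient\<close>

text \<open>
  The weights are read as complex numbers: gradient and second derivatives are computed there, and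
  real and imaginary parts are taken only at the end.
\<close>

definition weight_of :: "real ^ ('r::finite, 'n::finite) coords \<Rightarrow> 'r \<Rightarrow> complex" where
  "weight_of x i = complex_of_real (weights x $ i)"

definition vector_of :: "real ^ ('r::finite, 'n::finite) coords \<Rightarrow> 'r \<Rightarrow> complex ^ 'n" where
  "vector_of x i = column i (vectors x)"

lemma cnj_weight_of: "cnj (weight_of x i) = weight_of x i"
  by (simp add: weight_of_def)

text \<open>
  The closed form of the objective. Its two mixed terms are conjugate to each other and hence merge
  under the real part; only the variant that is holomorphic in the vectors is kept.
\<close>

lemma f_R_expand:
  fixes x :: "real ^ ('r::finite, 'n::finite) coords"
  assumes "homogeneous d p"
  shows "f_R d p x =
    Re (1 / 2 * (\<Sum>i\<in>UNIV. \<Sum>j\<in>UNIV. weight_of x i * weight_of x j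
        * star_prod (vector_of x i) (vector_of x j) ^ d)
      - (\<Sum>i\<in>UNIV. weight_of x i * poly_eval (conj_poly p) (vector_of x i)) + 1 / 2 * apolar d p p)"
proof -
  define S where "S = (\<Sum>i\<in>UNIV. const_poly (weight_of x i) * linear_form (vector_of x i) ^ d)"
  have SS: "apolar d S S = (\<Sum>i\<in>UNIV. \<Sum>j\<in>UNIV. weight_of x i * weight_of x j
      * star_prod (vector_of x i) (vector_of x j) ^ d)"
    unfolding S_def apolar_sum_left unfolding apolar_sum_right
    by (simp add: apolar_const_mult_left apolar_const_mult_right apolar_linear_form_powers cnj_weight_of mult_ac)
  have pS: "apolar d p S = (\<Sum>i\<in>UNIV. weight_of x i * poly_eval (conj_poly p) (vector_of x i))"
    by (simp add: S_def apolar_sum_right apolar_const_mult_right apolar_linear_form_power assms)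
  have "f_R d p x = 1 / 2 * Re (apolar d (S - p) (S - p))"
    by (simp add: f_R_def apolar_norm_squared S_def weight_of_def vector_of_def)
  also have "apolar d (S - p) (S - p) = apolar d S S - cnj (apolar d p S) - apolar d p S
      + apolar d p p"
    by (simp add: apolar_diff_left apolar_diff_right apolar_commute[of d S p] algebra_simps)
  also have "1 / 2 * Re \<dots> = Re (1 / 2 * apolar d S S - apolar d p S + 1 / 2 * apolar d p p)"
    by simp
  finally show ?thesis unfolding SS pS .
qed

lemma has_vector_derivative_power_complex:
  fixes f :: "real \<Rightarrow> complex"
  assumes "(f has_vector_derivative f') (at t)"
  shows "((\<lambda>t. f t ^ m) has_vector_derivative of_nat m * f t ^ (m - 1) * f') (at t)"
  using field_vector_diff_chain_at[OF assms DERIV_power[OF DERIV_ident, where n = m]]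
  by (simp add: o_def mult_ac)

lemma has_vector_derivative_vec_nth:
  assumes "(f has_vector_derivative f') (at t)"
  shows "((\<lambda>t. f t $ k) has_vector_derivative f' $ k) (at t)"
  by (rule bounded_linear.has_vector_derivative[OF bounded_linear_vec_nth assms])

lemma has_vector_derivative_star_prod:
  assumes "(u has_vector_derivative u') (at t)" "(v has_vector_derivative v') (at t)"
  shows "((\<lambda>t. star_prod (u t) (v t)) has_vector_derivative
    (star_prod u' (v t) + star_prod (u t) v')) (at t)"
  unfolding star_prod_def
  by (rule derivative_eq_intros has_vector_derivative_mult has_vector_derivative_cnj
      has_vector_derivative_vec_nth assms refl)+ (simp add: sum.distrib add.commute)

text \<open>
  The product rule. When the exponent of \<open>k\<close> is 0, the truncated exponent
  on the right is wrong, but the factor in front of it vanishes.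
\<close>

lemma has_vector_derivative_monom_eval:
  fixes v :: "real \<Rightarrow> complex ^ 'n::finite"
  assumes "(v has_vector_derivative v') (at t)"
  shows "((\<lambda>t. monom_eval (v t) \<alpha>) has_vector_derivative
    (\<Sum>k\<in>UNIV. of_nat (Poly_Mapping.lookup \<alpha> k) * monom_eval (v t) (\<alpha> - Poly_Mapping.single k 1)
        * v' $ k)) (at t)"
proof -
  let ?L = "Poly_Mapping.lookup \<alpha>"
  let ?f' = "\<lambda>k. of_nat (?L k) * (v t $ k) ^ (?L k - 1) * v' $ k"
  have "((\<lambda>t. (v t $ k) ^ ?L k) has_derivative (\<lambda>h. h *\<^sub>R ?f' k)) (at t)" for k
    using has_vector_derivative_power_complex[OF
        has_vector_derivative_vec_nth[OF assms], of k "?L k"]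
    by (simp add: has_vector_derivative_def)
  then have "((\<lambda>t. monom_eval (v t) \<alpha>) has_derivative
      (\<lambda>h. \<Sum>k\<in>UNIV. h *\<^sub>R ?f' k * (\<Prod>j\<in>UNIV - {k}. (v t $ j) ^ ?L j))) (at t)"
    unfolding monom_eval_def by (intro has_derivative_prod)
  moreover have eq: "?f' k * (\<Prod>j\<in>UNIV - {k}. (v t $ j) ^ ?L j)
      = of_nat (?L k) * monom_eval (v t) (\<alpha> - Poly_Mapping.single k 1) * v' $ k" for k
  proof -
    have "monom_eval (v t) (\<alpha> - Poly_Mapping.single k 1)
        = (v t $ k) ^ (?L k - 1) * (\<Prod>j\<in>UNIV - {k}. (v t $ j) ^ ?L j)"
      unfolding monom_eval_def
      by (simp add: prod.remove[OF finite UNIV_I, of _ k] lookup_minus lookup_single when_def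
          cong: prod.cong_simp)
    then show ?thesis by (simp add: mult_ac)
  qed
  ultimately show ?thesis
    unfolding has_vector_derivative_def scaleR_sum_right by (simp only: mult_scaleR_left eq)
qed

lemma poly_eval_pd:
  "poly_eval (poly_pd k q) x = (\<Sum>\<alpha>\<in>Poly_Mapping.keys q.
    of_nat (Poly_Mapping.lookup \<alpha> k) * Poly_Mapping.lookup q \<alpha>
      * monom_eval x (\<alpha> - Poly_Mapping.single k 1))"
  by (simp add: poly_pd_def poly_eval_sum poly_eval_single)

lemma has_vector_derivative_poly_eval:
  assumes "(v has_vector_derivative v') (at t)"
  shows "((\<lambda>t. poly_eval q (v t)) has_vector_derivative
    (\<Sum>k\<in>UNIV. poly_eval (poly_pd k q) (v t) * v' $ k)) (at t)"
proof -
  have "((\<lambda>t. poly_eval q (v t)) has_vector_derivative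
    (\<Sum>\<alpha>\<in>Poly_Mapping.keys q. Poly_Mapping.lookup q \<alpha> * (\<Sum>k\<in>UNIV. of_nat (Poly_Mapping.lookup \<alpha> k)
        * monom_eval (v t) (\<alpha> - Poly_Mapping.single k 1) * v' $ k))) (at t)"
    unfolding poly_eval_def monom_eval_def[symmetric]
    by (intro has_vector_derivative_sum has_vector_derivative_mult_right
        has_vector_derivative_monom_eval assms)
  also have "(\<Sum>\<alpha>\<in>Poly_Mapping.keys q. Poly_Mapping.lookup q \<alpha>
      * (\<Sum>k\<in>UNIV. of_nat (Poly_Mapping.lookup \<alpha> k)
        * monom_eval (v t) (\<alpha> - Poly_Mapping.single k 1) * v' $ k))
      = (\<Sum>k\<in>UNIV. poly_eval (poly_pd k q) (v t) * v' $ k)"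
    unfolding poly_eval_pd sum_distrib_left sum_distrib_right
    by (subst sum.swap) (simp add: mult_ac)
  finally show ?thesis .
qed

text \<open>
  The complex number whose real part is the derivative of the objective with respect to the
  weight \<open>w\<^sub>i\<close>.
\<close>

definition weight_grad :: "nat \<Rightarrow> 'n::finite cpoly \<Rightarrow> real ^ ('r::finite, 'n) coords \<Rightarrow> 'r \<Rightarrow> complex" where
  "weight_grad d p x i = (\<Sum>j\<in>UNIV. weight_of x j * star_prod (vector_of x j) (vector_of x i) ^ d)
      - poly_eval (conj_poly p) (vector_of x i)"

text \<open>
  Twice the Wirtinger derivative of the objective with respect to the coordinate $v_{j,l}$.
\<close>

definition vector_grad :: "nat \<Rightarrow> 'n::finite cpoly \<Rightarrow> real ^ ('r::finite, 'n) coords \<Rightarrow> 'r \<Rightarrow> 'n \<Rightarrow> complex" where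
  "vector_grad d p x j l = weight_of x j *
    (of_nat d * (\<Sum>m\<in>UNIV. weight_of x m * star_prod (vector_of x m) (vector_of x j) ^ (d - 1)
        * cnj (vector_of x m $ l))
      - poly_eval (poly_pd l (conj_poly p)) (vector_of x j))"

text \<open>
  Weights and vectors depend linearly on the point, so the direction \<open>e\<close> itself supplies their
  derivatives.
\<close>

lemma weight_of_line: "((\<lambda>t. weight_of (x + t *\<^sub>R e) i) has_vector_derivative weight_of e i) (at 0)"
proof -
  have "((\<lambda>t. weight_of x i + t *\<^sub>R weight_of e i) has_vector_derivative weight_of e i) (at 0)"
    by (auto intro!: derivative_eq_intros)
  moreover have "weight_of (x + t *\<^sub>R e) i = weight_of x i + t *\<^sub>R weight_of e i" for t
    by (simp add: weight_of_def weights_def complex_eq_iff)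
  ultimately show ?thesis by simp
qed

lemma vector_of_line: "((\<lambda>t. vector_of (x + t *\<^sub>R e) i) has_vector_derivative vector_of e i) (at 0)"
proof -
  have "((\<lambda>t. vector_of x i + t *\<^sub>R vector_of e i) has_vector_derivative vector_of e i) (at 0)"
    by (auto intro!: derivative_eq_intros)
  moreover have "vector_of (x + t *\<^sub>R e) i = vector_of x i + t *\<^sub>R vector_of e i" for t
    by (simp add: vector_of_def vectors_def vec_eq_iff column_def complex_eq_iff)
  ultimately show ?thesis by simp
qed

lemma has_real_derivative_Re_of_vector:
  assumes "(f has_vector_derivative f') (at t)"
  shows "((\<lambda>t. Re (f t)) has_real_derivative Re f') (at t)"
  using bounded_linear.has_vector_derivative[OF bounded_linear_Re assms]
  by (simp add: has_real_derivative_iff_has_vector_derivative)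

lemma has_real_derivative_Im_of_vector:
  assumes "(f has_vector_derivative f') (at t)"
  shows "((\<lambda>t. Im (f t)) has_real_derivative Im f') (at t)"
  using bounded_linear.has_vector_derivative[OF bounded_linear_Im assms]
  by (simp add: has_real_derivative_iff_has_vector_derivative)

lemma star_prod_commute: "star_prod v u = cnj (star_prod u v)"
  by (simp add: star_prod_def mult.commute)

lemmas line_intros = has_vector_derivative_sum has_vector_derivative_diff has_vector_derivative_add
  has_vector_derivative_mult has_vector_derivative_mult_right has_vector_derivative_power_complex
  has_vector_derivative_star_prod has_vector_derivative_poly_eval has_vector_derivative_cnj
  has_vector_derivative_vec_nth weight_of_line vector_of_line has_vector_derivative_const

lemma weight_grad_line:
  "((\<lambda>t. weight_grad d p (x + t *\<^sub>R e) i) has_vector_derivative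
    (\<Sum>j\<in>UNIV. weight_of e j * star_prod (vector_of x j) (vector_of x i) ^ d
        + weight_of x j * (of_nat d * star_prod (vector_of x j) (vector_of x i) ^ (d - 1)
           * (star_prod (vector_of e j) (vector_of x i)
               + star_prod (vector_of x j) (vector_of e i))))
    - (\<Sum>k\<in>UNIV. poly_eval (poly_pd k (conj_poly p)) (vector_of x i) * vector_of e i $ k)) (at 0)"
  unfolding weight_grad_def
  by (rule has_vector_derivative_eq_rhs, (rule line_intros)+) (simp add: add.commute)

text \<open>
  The three terms under the sum come from the weights, from the scalar products and from the
  explicit conjugated coordinate. In a scalar product, a change of its second argument contributes
  to the block \<open>C\<close>, a change of its first, conjugated argument to the rank-one summand of \<open>D\<close>; the
  conjugated coordinate leads to the other summand of \<open>D\<close>.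
\<close>

lemma vector_grad_line:
  "((\<lambda>t. vector_grad d p (x + t *\<^sub>R e) j l) has_vector_derivative
    (weight_of e j * (of_nat d * (\<Sum>m\<in>UNIV. weight_of x m
        * star_prod (vector_of x m) (vector_of x j) ^ (d - 1) * cnj (vector_of x m $ l))
      - poly_eval (poly_pd l (conj_poly p)) (vector_of x j))
    + weight_of x j * (of_nat d * (\<Sum>m\<in>UNIV.
          weight_of e m * star_prod (vector_of x m) (vector_of x j) ^ (d - 1)
              * cnj (vector_of x m $ l)
        + weight_of x m * (of_nat (d - 1) * star_prod (vector_of x m) (vector_of x j) ^ (d - 2)
            * (star_prod (vector_of e m) (vector_of x j)
                + star_prod (vector_of x m) (vector_of e j))) * cnj (vector_of x m $ l)
        + weight_of x m * star_prod (vector_of x m) (vector_of x j) ^ (d - 1)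
            * cnj (vector_of e m $ l))
      - (\<Sum>k\<in>UNIV. poly_eval (poly_pd k (poly_pd l (conj_poly p))) (vector_of x j)
          * vector_of e j $ k)))) (at 0)"
  unfolding vector_grad_def
  by (rule has_vector_derivative_eq_rhs, (rule line_intros)+)
    (simp add: algebra_simps numeral_2_eq_2)

text \<open>
  The quadratic part is a Hermitian form in the summands $w_i (v_i^t x)^d$, so its derivative is
  \<open>X + cnj X\<close>, where \<open>X\<close> collects the terms that come from moving the second argument. The factor
  1/2 and the real part reduce this to \<open>X\<close>.
\<close>

lemma f_R_line:
  assumes "homogeneous d p"
  shows "((\<lambda>t. f_R d p (x + t *\<^sub>R e)) has_real_derivative
    Re ((\<Sum>i\<in>UNIV. weight_of e i * weight_grad d p x i)
      + (\<Sum>i\<in>UNIV. \<Sum>k\<in>UNIV. vector_grad d p x i k * vector_of e i $ k))) (at 0)"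
proof -
  let ?S = "\<lambda>i j. star_prod (vector_of x i) (vector_of x j)"
  let ?q = "conj_poly p"
  define X where "X = (\<Sum>i\<in>UNIV. \<Sum>j\<in>UNIV. weight_of x i * weight_of e j * ?S i j ^ d
    + weight_of x i * weight_of x j * (of_nat d * ?S i j ^ (d - 1)
        * star_prod (vector_of x i) (vector_of e j)))"
  define P where "P = (\<Sum>i\<in>UNIV. weight_of e i * poly_eval ?q (vector_of x i)
      + weight_of x i * (\<Sum>k\<in>UNIV. poly_eval (poly_pd k ?q) (vector_of x i) * vector_of e i $ k))"
  \<comment> \<open>Conjugation exchanges the two arguments of every scalar product, hence the roles of \<open>i\<close> and \<open>j\<close>.\<close>
  have "cnj X = (\<Sum>i\<in>UNIV. \<Sum>j\<in>UNIV. weight_of e i * weight_of x j * ?S i j ^ d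
    + weight_of x i * weight_of x j * (of_nat d * ?S i j ^ (d - 1)
        * star_prod (vector_of e i) (vector_of x j)))"
    unfolding X_def
    by (subst sum.swap) (simp add: cnj_weight_of star_prod_commute[symmetric] mult_ac)
  then have sym: "X + cnj X = (\<Sum>i\<in>UNIV. \<Sum>j\<in>UNIV.
      (weight_of x i * weight_of e j + weight_of e i * weight_of x j) * ?S i j ^ d
      + weight_of x i * weight_of x j * (of_nat d * ?S i j ^ (d - 1)
          * (star_prod (vector_of e i) (vector_of x j)
              + star_prod (vector_of x i) (vector_of e j))))"
    by (simp add: X_def sum.distrib[symmetric] algebra_simps)
  have "((\<lambda>t. 1 / 2 * (\<Sum>i\<in>UNIV. \<Sum>j\<in>UNIV. weight_of (x + t *\<^sub>R e) i * weight_of (x + t *\<^sub>R e) j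
          * star_prod (vector_of (x + t *\<^sub>R e) i) (vector_of (x + t *\<^sub>R e) j) ^ d)
      - (\<Sum>i\<in>UNIV. weight_of (x + t *\<^sub>R e) i * poly_eval ?q (vector_of (x + t *\<^sub>R e) i))
      + 1 / 2 * apolar d p p)
    has_vector_derivative (1 / 2 * (X + cnj X) - P)) (at 0)"
    unfolding sym P_def
    by (rule has_vector_derivative_eq_rhs, (rule line_intros)+) (simp add: algebra_simps)
  from has_real_derivative_Re_of_vector[OF this] have "((\<lambda>t. f_R d p (x + t *\<^sub>R e))
      has_real_derivative
      Re (1 / 2 * (X + cnj X) - P)) (at 0)"
    by (simp only: f_R_expand[OF assms])
  also have "Re (1 / 2 * (X + cnj X) - P) = Re (X - P)"
    by simp
  also have "X - P = (\<Sum>i\<in>UNIV. weight_of e i * weight_grad d p x i)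
      + (\<Sum>i\<in>UNIV. \<Sum>k\<in>UNIV. vector_grad d p x i k * vector_of e i $ k)"
  proof -
    have 1: "(\<Sum>k\<in>UNIV. vector_grad d p x i k * vector_of e i $ k) =
      (\<Sum>m\<in>UNIV. weight_of x m * weight_of x i * (of_nat d * ?S m i ^ (d - 1)
          * star_prod (vector_of x m) (vector_of e i)))
      - weight_of x i * (\<Sum>k\<in>UNIV. poly_eval (poly_pd k ?q) (vector_of x i)
          * vector_of e i $ k)" for i
    proof -
      have "(\<Sum>m\<in>UNIV. weight_of x m * weight_of x i * (of_nat d * ?S m i ^ (d - 1)
          * star_prod (vector_of x m) (vector_of e i)))
        = (\<Sum>k\<in>UNIV. \<Sum>m\<in>UNIV. weight_of x m * weight_of x i * (of_nat d * ?S m i ^ (d - 1)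
            * (cnj (vector_of x m $ k) * vector_of e i $ k)))"
        unfolding star_prod_def[of _ "vector_of e i"] sum_distrib_left by (rule sum.swap)
      then show ?thesis
        by (simp add: vector_grad_def right_diff_distrib left_diff_distrib sum_subtractf sum_distrib_left
            sum_distrib_right mult_ac)
    qed
    show ?thesis
      unfolding 1 X_def P_def weight_grad_def
      by (subst sum.swap)
        (simp add: sum.distrib sum_subtractf right_diff_distrib sum_distrib_left mult_ac)
  qed
  finally show ?thesis .
qed

section \<open>Derivatives of the gradient along the coordinate axes\<close>

lemma weight_of_axis_Inl: "weight_of (axis (Inl i) 1) j = (if j = i then 1 else 0)"
  by (simp add: weight_of_def weights_def axis_def)

lemma vector_of_axis_Inl: "vector_of (axis (Inl i) 1) j = 0"
  by (simp add: vector_of_def vectors_def column_def vec_eq_iff axis_def complex_eq_iff)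

lemma weight_of_axis_Inr: "weight_of (axis (Inr s) 1) j = 0"
  by (simp add: weight_of_def weights_def axis_def)

lemma vector_of_axis_Re: "vector_of (axis (Inr (Inl (i, k))) 1) j = (if j = i then axis k 1 else 0)"
  by (auto simp: vector_of_def vectors_def column_def vec_eq_iff axis_def complex_eq_iff)

lemma vector_of_axis_Im: "vector_of (axis (Inr (Inr (i, k))) 1) j = (if j = i then axis k \<i> else 0)"
  by (auto simp: vector_of_def vectors_def column_def vec_eq_iff axis_def complex_eq_iff)

lemma mult_if_zero:
  fixes a b :: "'a::mult_zero"
  shows "(if P then a else 0) * b = (if P then a * b else 0)"
    and "b * (if P then a else 0) = (if P then b * a else 0)"
  by simp_all

lemma star_prod_axis_left: "star_prod (axis k c) v = cnj c * v $ k"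
  by (simp add: star_prod_def axis_def if_distrib[of cnj] mult_if_zero cong: if_cong)

lemma star_prod_axis_right: "star_prod u (axis k c) = cnj (u $ k) * c"
  by (simp add: star_prod_def axis_def mult_if_zero)

lemma star_prod_0_left: "star_prod 0 v = 0"
  by (simp add: star_prod_def)

lemma star_prod_0_right: "star_prod u 0 = 0"
  by (simp add: star_prod_def)

text \<open>
  A step of \<open>1\<close> or \<open>\<i>\<close> in $v_{i,k}$ changes the objective by the real part of \<open>1\<close> or \<open>\<i>\<close> times the
  holomorphic gradient; the second gives the negative imaginary part.
\<close>

definition f_R_grad ::
  "nat \<Rightarrow> 'n::finite cpoly \<Rightarrow> ('r::finite, 'n) coords \<Rightarrow> real ^ ('r, 'n) coords \<Rightarrow> real" where
  "f_R_grad d p s x = (case s of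
      Inl i \<Rightarrow> Re (weight_grad d p x i)
    | Inr (Inl (i, k)) \<Rightarrow> Re (vector_grad d p x i k)
    | Inr (Inr (i, k)) \<Rightarrow> - Im (vector_grad d p x i k))"

lemma sum_if_axis:
  "(\<Sum>k\<in>UNIV. f k * (if P then axis l c else 0) $ k) = (if P then f l * c else (0 :: complex))"
  by (simp add: axis_def mult_if_zero)

lemma f_R_has_partial_deriv:
  assumes "homogeneous d p"
  shows "has_partial_deriv (f_R d p) s (f_R_grad d p s x) x"
proof -
  have "Re ((\<Sum>i\<in>UNIV. weight_of (axis s 1) i * weight_grad d p x i)
      + (\<Sum>i\<in>UNIV. \<Sum>k\<in>UNIV. vector_grad d p x i k * vector_of (axis s 1) i $ k)) = f_R_grad d p s x"
  proof -
    consider (w) i where "s = Inl i" | (a) i k where "s = Inr (Inl (i, k))"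
      | (b) i k where "s = Inr (Inr (i, k))"
      by (metis sum.exhaust surj_pair)
    then show ?thesis
    proof cases
      case w
      then show ?thesis by (simp add: f_R_grad_def weight_of_axis_Inl vector_of_axis_Inl mult_if_zero)
    next
      case a
      show ?thesis
        unfolding a weight_of_axis_Inr vector_of_axis_Re sum_if_axis
            by (simp add: f_R_grad_def del: Re_sum)
    next
      case b
      show ?thesis
        unfolding b weight_of_axis_Inr vector_of_axis_Im sum_if_axis
            by (simp add: f_R_grad_def del: Re_sum)
    qed
  qed
  then show ?thesis
    unfolding has_partial_deriv_def using f_R_line[OF assms, of x "axis s 1"] by simp
qed

lemma weight_grad_line_weight:
  "((\<lambda>t. weight_grad d p (x + t *\<^sub>R axis (Inl i) 1) j) has_vector_derivative
    star_prod (vector_of x i) (vector_of x j) ^ d) (at 0)"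
  by (rule has_vector_derivative_eq_rhs[OF weight_grad_line])
    (simp add: weight_of_axis_Inl vector_of_axis_Inl star_prod_0_left star_prod_0_right mult_if_zero)

lemma hess_B_entry:
  "hess_B d p (weights x) (vectors x) $ (i, k) $ j =
    of_nat d * weight_of x i * star_prod (vector_of x j) (vector_of x i) ^ (d - 1)
        * cnj (vector_of x j $ k)
    + (if i = j
       then of_nat d * (\<Sum>l\<in>UNIV. weight_of x l * star_prod (vector_of x l) (vector_of x i) ^ (d
           - 1) * cnj (vector_of x l $ k))
            - poly_eval (poly_pd k (conj_poly p)) (vector_of x j)
       else 0)"
  by (simp add: hess_B_def block_vectors_def Let_def weight_of_def vector_of_def conj_vec_def poly_grad_def)

lemma hess_C_entry:
  "hess_C d p (weights x) (vectors x) $ (i, k) $ (j, l) =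
    (if i = j then of_nat (d * (d - 1)) * (\<Sum>m\<in>UNIV. weight_of x m * weight_of x j
        * cnj (vector_of x m $ k)
        * cnj (vector_of x m $ l) * star_prod (vector_of x m) (vector_of x j) ^ (d - 2))
      - weight_of x j * poly_eval (poly_pd k (poly_pd l (conj_poly p))) (vector_of x j) else 0)"
  by (simp add: hess_C_def block_diag_def block_matrix_def Let_def weight_of_def vector_of_def poly_hess_def)

lemma hess_D_entry:
  "hess_D d (weights x) (vectors x) $ (i, k) $ (j, l) =
    of_nat d * weight_of x i * weight_of x j * star_prod (vector_of x i) (vector_of x j) ^ (d - 2)
    * (star_prod (vector_of x i) (vector_of x j) * (if k = l then 1 else 0)
      + of_nat (d - 1) * (vector_of x j $ k * cnj (vector_of x i $ l)))"
  by (simp add: hess_D_def block_matrix_def Let_def weight_of_def vector_of_def mat_def)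

lemma vector_grad_line_weight:
  "((\<lambda>t. vector_grad d p (x + t *\<^sub>R axis (Inl i) 1) j l) has_vector_derivative
    hess_B d p (weights x) (vectors x) $ (j, l) $ i) (at 0)"
  by (rule has_vector_derivative_eq_rhs[OF vector_grad_line],
      unfold hess_B_entry weight_of_axis_Inl vector_of_axis_Inl star_prod_0_left star_prod_0_right mult_if_zero)
    (simp add: mult_ac)

text \<open>
  Moving $v_{i,k}$ by \<open>c\<close> changes the derivative in \<open>w\<^sub>j\<close> by a term linear in \<open>c\<close> and a term linear
  in the conjugate of \<open>c\<close>. Only the real part is at stake, so the second may be conjugated; then
  both are \<open>c\<close> times the two summands of \<open>B\<close>.
\<close>

lemma weight_grad_line_vector:
  assumes weight: "\<And>j. weight_of e j = 0" and vector: "\<And>j. vector_of e j = (if j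
      = i then axis k c else 0)"
  shows "((\<lambda>t. Re (weight_grad d p (x + t *\<^sub>R e) j)) has_real_derivative
    Re (c * hess_B d p (weights x) (vectors x) $ (i, k) $ j)) (at 0)"
proof -
  let ?S = "\<lambda>i j. star_prod (vector_of x i) (vector_of x j)"
  \<comment> \<open>The entry of \<open>B\<close> is \<open>?T + ?\<delta>\<close>, but the derivative yields \<open>?T\<close> in conjugated form.\<close>
  let ?\<delta> = "if i = j then of_nat d * (\<Sum>l\<in>UNIV. weight_of x l * ?S l i ^ (d - 1)
      * cnj (vector_of x l $ k))
            - poly_eval (poly_pd k (conj_poly p)) (vector_of x j) else 0"
  let ?T = "of_nat d * weight_of x i * ?S j i ^ (d - 1) * cnj (vector_of x j $ k)"
  have 1: "star_prod (vector_of e m) (vector_of x j) = (if m = i then cnj c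
      * vector_of x j $ k else 0)" for m
    by (simp add: vector star_prod_axis_left star_prod_0_left)
  have 2: "star_prod (vector_of x m) (vector_of e j) = (if j = i then cnj (vector_of x m $ k)
      * c else 0)" for m
    by (simp add: vector star_prod_axis_right star_prod_0_right)
  have 3: "(\<Sum>m\<in>UNIV. weight_of e m * ?S m j ^ d + weight_of x m * (of_nat d * ?S m j ^ (d - 1)
        * (star_prod (vector_of e m) (vector_of x j) + star_prod (vector_of x m) (vector_of e j))))
    = weight_of x i * (of_nat d * ?S i j ^ (d - 1) * (cnj c * vector_of x j $ k))
      + (if j = i then \<Sum>m\<in>UNIV. weight_of x m * (of_nat d * ?S m j ^ (d - 1)
          * (cnj (vector_of x m $ k) * c)) else 0)"
    by (simp add: weight 1 2 sum.distrib distrib_left mult_if_zero)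
  have 4: "cnj (c * ?T) = weight_of x i * (of_nat d * ?S i j ^ (d - 1) * (cnj c
      * vector_of x j $ k))"
    by (simp add: cnj_weight_of star_prod_commute[of "vector_of x j" "vector_of x i"])
  have "((\<lambda>t. weight_grad d p (x + t *\<^sub>R e) j) has_vector_derivative cnj (c * ?T) + c * ?\<delta>) (at 0)"
    by (rule has_vector_derivative_eq_rhs[OF weight_grad_line], unfold 3 4)
      (auto simp: vector[of j] sum_if_axis sum_distrib_left right_diff_distrib mult_ac)
  from has_real_derivative_Re_of_vector[OF this] show ?thesis
    by (simp only: hess_B_entry distrib_left plus_complex.sel cnj.sel)
qed

text \<open>
  The heart of the matter: \<open>C\<close> is the holomorphic and \<open>D\<close> the antiholomorphic part of the
  derivative of the gradient. The direction \<open>c\<close> is kept arbitrary so that \<open>c = 1\<close> and \<open>c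
      = \<i>\<close> give the
  rows for the real and for the imaginary parts.
\<close>

lemma vector_grad_line_vector:
  assumes weight: "\<And>j. weight_of e j = 0" and vector: "\<And>j. vector_of e j = (if j
      = i then axis k c else 0)"
    and "d \<ge> 2"
  shows "((\<lambda>t. vector_grad d p (x + t *\<^sub>R e) j l) has_vector_derivative
    (c * hess_C d p (weights x) (vectors x) $ (i, k) $ (j, l)
      + cnj c * hess_D d (weights x) (vectors x) $ (i, k) $ (j, l))) (at 0)"
proof -
  let ?S = "\<lambda>i j. star_prod (vector_of x i) (vector_of x j)"
  have 1: "star_prod (vector_of e m) (vector_of x j) = (if m = i then cnj c
      * vector_of x j $ k else 0)" for m
    by (simp add: vector star_prod_axis_left star_prod_0_left)
  have 2: "star_prod (vector_of x m) (vector_of e j) = (if j = i then cnj (vector_of x m $ k)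
      * c else 0)" for m
    by (simp add: vector star_prod_axis_right star_prod_0_right)
  have 3: "cnj (vector_of e m $ l) = (if m = i then (if k = l then cnj c else 0) else 0)" for m
    by (auto simp: vector axis_def)
  have 4: "(\<Sum>m\<in>UNIV. weight_of e m * ?S m j ^ (d - 1) * cnj (vector_of x m $ l)
        + weight_of x m * (of_nat (d - 1) * ?S m j ^ (d - 2)
            * (star_prod (vector_of e m) (vector_of x j)
                + star_prod (vector_of x m) (vector_of e j))) * cnj (vector_of x m $ l)
        + weight_of x m * ?S m j ^ (d - 1) * cnj (vector_of e m $ l))
    = weight_of x i * (of_nat (d - 1) * ?S i j ^ (d - 2) * (cnj c * vector_of x j $ k))
        * cnj (vector_of x i $ l)
      + (if j = i then \<Sum>m\<in>UNIV. weight_of x m * (of_nat (d - 1) * ?S m j ^ (d - 2)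
            * (cnj (vector_of x m $ k) * c)) * cnj (vector_of x m $ l) else 0)
      + weight_of x i * ?S i j ^ (d - 1) * (if k = l then cnj c else 0)"
    by (simp add: weight 1 2 3 sum.distrib distrib_left distrib_right mult_if_zero)
  \<comment> \<open>The block \<open>D\<close> has the power \<open>d - 2\<close> factored out.\<close>
  have pow: "?S i j ^ (d - 1) = ?S i j ^ (d - 2) * ?S i j"
    using \<open>d \<ge> 2\<close> by (metis Suc_1 Suc_diff_le diff_Suc_Suc power_Suc2)
  have nat_mult: "of_nat (d * (d - 1)) = of_nat d * (of_nat (d - 1) :: complex)"
    by (rule of_nat_mult)
  show ?thesis
    by (rule has_vector_derivative_eq_rhs[OF vector_grad_line], subst 4)
      (auto simp: hess_C_entry hess_D_entry vector[of j] sum_if_axis weight pow nat_mult distrib_left distrib_right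
        right_diff_distrib sum_distrib_left mult_ac simp del: of_nat_mult of_nat_diff One_nat_def diff_Suc_1)
qed

section \<open>The Hessian\<close>

text \<open>
  Rows select the direction of the second derivative (\<open>c = 1\<close> or \<open>c
      = \<i>\<close>), columns select the real or
  the negative imaginary part of the gradient. For instance, the row of an imaginary part gives
  $\mathrm i C - \mathrm i D$, whose real part is $\Im(D - C)$ and whose negative imaginary part is
  $\Re(D - C)$.
\<close>

lemma f_R_grad_has_partial_deriv:
  fixes p :: "'n::finite cpoly" and x :: "real ^ ('r::finite, 'n) coords"
  assumes d: "d \<ge> 2"
    and A: "A = hess_A d (vectors x)"
    and B: "B = hess_B d p (weights x) (vectors x)"
    and C: "C = hess_C d p (weights x) (vectors x)"
    and D: "D = hess_D d (weights x) (vectors x)"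
  shows "has_partial_deriv (f_R_grad d p t) s
    ((vcat (hcat A                      (hcat (transpose (map_matrix Re B)) (- transpose (map_matrix Im B))))
    (vcat (hcat (map_matrix Re B)      (hcat (map_matrix Re (C + D))       (- map_matrix Im (C + D))))
          (hcat (- map_matrix Im B)    (hcat (map_matrix Im (D - C))       (map_matrix Re (D - C)))))) $ s $ t)
    x"
proof -
  consider (w) i where "s = Inl i" | (a) i k where "s = Inr (Inl (i, k))"
    | (b) i k where "s = Inr (Inr (i, k))"
    by (metis sum.exhaust surj_pair)
  note s_cases = this
  consider (w) i where "t = Inl i" | (a) i k where "t = Inr (Inl (i, k))"
    | (b) i k where "t = Inr (Inr (i, k))"
    by (metis sum.exhaust surj_pair)
  note t_cases = this
  note entries = has_partial_deriv_def f_R_grad_def hcat_def vcat_def map_matrix_def transpose_def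
    A B C D
  have Ax: "hess_A d (vectors x) $ i $ j = Re (star_prod (vector_of x i) (vector_of x j) ^ d)" for i j
    by (simp add: hess_A_def map_matrix_def vector_of_def)
  note vector_Re = vector_grad_line_vector[OF weight_of_axis_Inr vector_of_axis_Re d, of p x]
    and vector_Im = vector_grad_line_vector[OF weight_of_axis_Inr vector_of_axis_Im d, of p x]
    and weight_Re = weight_grad_line_vector[OF weight_of_axis_Inr vector_of_axis_Re, of d p x]
    and weight_Im = weight_grad_line_vector[OF weight_of_axis_Inr vector_of_axis_Im, of d p x]
  note vector_weight = vector_grad_line_weight[of d p x]
  show ?thesis
  proof (cases rule: s_cases; cases rule: t_cases)
    fix i j assume s: "s = Inl i" and t: "t = Inl j"
    show ?thesis using has_real_derivative_Re_of_vector[OF weight_grad_line_weight[of d p x i j]]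
        by (simp add: s t entries Ax)
  next
    fix i j l assume s: "s = Inl i" and t: "t = Inr (Inl (j, l))"
    show ?thesis using has_real_derivative_Re_of_vector[OF vector_weight[of i j l]]
        by (simp add: s t entries)
  next
    fix i j l assume s: "s = Inl i" and t: "t = Inr (Inr (j, l))"
    show ?thesis using DERIV_minus[OF has_real_derivative_Im_of_vector[OF vector_weight[of i j l]]] by (simp add: s t entries)
  next
    fix i k j assume s: "s = Inr (Inl (i, k))" and t: "t = Inl j"
    show ?thesis using weight_Re[of i k j] by (simp add: s t entries)
  next
    fix i k j l assume s: "s = Inr (Inl (i, k))" and t: "t = Inr (Inl (j, l))"
    show ?thesis using has_real_derivative_Re_of_vector[OF vector_Re[of i k j l]]
        by (simp add: s t entries)
  next
    fix i k j l assume s: "s = Inr (Inl (i, k))" and t: "t = Inr (Inr (j, l))"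
    show ?thesis using DERIV_minus[OF has_real_derivative_Im_of_vector[OF vector_Re[of i k j l]]]
        by (simp add: s t entries)
  next
    fix i k j assume s: "s = Inr (Inr (i, k))" and t: "t = Inl j"
    show ?thesis using weight_Im[of i k j] by (simp add: s t entries)
  next
    fix i k j l assume s: "s = Inr (Inr (i, k))" and t: "t = Inr (Inl (j, l))"
    show ?thesis using has_real_derivative_Re_of_vector[OF vector_Im[of i k j l]]
        by (simp add: s t entries)
  next
    fix i k j l assume s: "s = Inr (Inr (i, k))" and t: "t = Inr (Inr (j, l))"
    show ?thesis using DERIV_minus[OF has_real_derivative_Im_of_vector[OF vector_Im[of i k j l]]]
        by (simp add: s t entries)
  qed
qed

theorem proposition4p6:
  fixes d :: nat
    and p :: "'n::finite cpoly"
    and W :: "real ^ 'r::finite"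
    and V :: "complex ^ 'r ^ 'n"
    and A :: "real ^ 'r ^ 'r"
    and B :: "complex ^ 'r ^ ('r \<times> 'n)"
    and C D :: "complex ^ ('r \<times> 'n) ^ ('r \<times> 'n)"
  assumes "d > 2"
    and "CARD('r) < generic_rank d CARD('n)"
    and "homogeneous d p"
    and "A = hess_A d V"
    and "B = hess_B d p W V"
    and "C = hess_C d p W V"
    and "D = hess_D d W V"
  shows "has_hessian (f_R d p)
    (vcat (hcat A                      (hcat (transpose (map_matrix Re B)) (- transpose (map_matrix Im B))))
    (vcat (hcat (map_matrix Re B)      (hcat (map_matrix Re (C + D))       (- map_matrix Im (C + D))))
          (hcat (- map_matrix Im B)    (hcat (map_matrix Im (D - C))       (map_matrix Re (D - C))))))
    (real_point W V)"
  unfolding has_hessian_def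
proof (intro exI[of _ "f_R_grad d p"] conjI allI)
  show "\<forall>\<^sub>F y in nhds (real_point W V). has_partial_deriv (f_R d p) j (f_R_grad d p j y) y"
    for j
    by (intro always_eventually allI f_R_has_partial_deriv \<open>homogeneous d p\<close>)
next
  fix s t :: "('r, 'n) coords"
  show "has_partial_deriv (f_R_grad d p t)
     s ((vcat (hcat A                      (hcat (transpose (map_matrix Re B)) (- transpose (map_matrix Im B))))
    (vcat (hcat (map_matrix Re B)      (hcat (map_matrix Re (C + D))       (- map_matrix Im (C + D))))
          (hcat (- map_matrix Im B)    (hcat (map_matrix Im (D - C))       (map_matrix Re (D - C)))))) $ s $ t)
    (real_point W V)"
    by (rule f_R_grad_has_partial_deriv) (use assms in simp_all)
qed

end
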